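(* Consider a sporadic self-suspending task system with implicit deadlines scheduled by global rate-monotonic (RM) scheduling on $M$ identical processors. Let $\tau_k$ be a task with $k-1$ higher-priority tasks $\tau_1,\dots,\tau_{k-1}$, which are assumed to be schedulable. Then $\tau_k$ is schedulable by global RM on the $M$ processors if $$\left(\frac{C_k+S_k}{T_k}+2\right)\prod_{j=1}^{k-1}\left(\frac{U_j}{M}+1\right)\le 3.$$
   Context: A sporadic self-suspending task $\tau_i$ releases jobs with consecutive releases at least $T_i$ (its period) apart; with implicit deadlines, a job released at $r$ has absolute deadline $r+T_i$. Jobs of a task execute in sequence. Each job alternates between computation and suspension phases (arbitrary number and interleaving of phases, possibly different for different jobs, possibly starting or ending with a suspension); it executes for at most $C_i>0$ time units in total and suspends for at most $S_i\ge0$ time units in total, where $C_i+S_i\le T_i$. A suspended job is not ready for execution. $U_i=C_i/T_i$. Global RM: priorities are fixed, tasks with smaller periods have higher priority (so $T_i\le T_k$ for $i<k$, ties broken arbitrarily), scheduling is preemptive with migration, and at any time the (up to) $M$ highest-priority ready jobs are executed on the $M$ processors. A task is schedulable if all its jobs always finish by their absolute deadlines. $k\ge 2$. *)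

theory Defs
  imports "HOL-Analysis.Analysis"
begin

record task =
  period :: real
  wcet :: real
  max_susp :: real

definition utilization :: "task \<Rightarrow> real" where
  "utilization \<tau> = wcet \<tau> / period \<tau>"

(* Tasks are indexed by 1..n; a smaller index means a higher priority, so the order of tasks
   with equal periods encodes the (arbitrary) tie-breaking. *)
definition task_system :: "nat \<Rightarrow> (nat \<Rightarrow> task) \<Rightarrow> bool" where
  "task_system n \<tau> \<longleftrightarrow>
     (\<forall>i\<in>{1..n}. wcet (\<tau> i) > 0 \<and> max_susp (\<tau> i) \<ge> 0 \<and>
                 wcet (\<tau> i) + max_susp (\<tau> i) \<le> period (\<tau> i))"

definition rate_monotonic :: "nat \<Rightarrow> (nat \<Rightarrow> task) \<Rightarrow> bool" where
  "rate_monotonic n \<tau> \<longleftrightarrow>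
     (\<forall>i\<in>{1..n}. \<forall>k\<in>{1..n}. i < k \<longrightarrow> period (\<tau> i) \<le> period (\<tau> k))"

datatype phase = Comp real | Susp real

fun phase_length :: "phase \<Rightarrow> real" where
  "phase_length (Comp c) = c"
| "phase_length (Susp s) = s"

fun is_comp :: "phase \<Rightarrow> bool" where
  "is_comp (Comp c) = True"
| "is_comp (Susp s) = False"

definition comp_time :: "phase list \<Rightarrow> real" where
  "comp_time ps = (\<Sum>p\<leftarrow>filter is_comp ps. phase_length p)"

definition susp_time :: "phase list \<Rightarrow> real" where
  "susp_time ps = (\<Sum>p\<leftarrow>filter (\<lambda>p. \<not> is_comp p) ps. phase_length p)"

(* The j-th job of task i exists iff enat j < num_jobs i, so that a task may release finitely or
   infinitely many jobs. *)
record scenario =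
  num_jobs :: "nat \<Rightarrow> enat"
  release :: "nat \<Rightarrow> nat \<Rightarrow> real"
  phases :: "nat \<Rightarrow> nat \<Rightarrow> phase list"

definition admissible_job :: "task \<Rightarrow> phase list \<Rightarrow> bool" where
  "admissible_job \<tau> ps \<longleftrightarrow>
     (\<forall>p\<in>set ps. phase_length p > 0) \<and> distinct_adj (map is_comp ps) \<and>
     comp_time ps \<le> wcet \<tau> \<and> susp_time ps \<le> max_susp \<tau>"

definition admissible_scenario :: "nat \<Rightarrow> (nat \<Rightarrow> task) \<Rightarrow> scenario \<Rightarrow> bool" where
  "admissible_scenario n \<tau> \<sigma> \<longleftrightarrow>
     (\<forall>i\<in>{1..n}.
        (\<forall>j. enat j < num_jobs \<sigma> i \<longrightarrow>
             release \<sigma> i j \<ge> 0 \<and> admissible_job (\<tau> i) (phases \<sigma> i j)) \<and>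
        (\<forall>j. enat (Suc j) < num_jobs \<sigma> i \<longrightarrow>
             release \<sigma> i j + period (\<tau> i) \<le> release \<sigma> i (Suc j)))"

(* A schedule maps task i and job number j to the set of instants at which that job executes. *)
type_synonym schedule = "nat \<Rightarrow> nat \<Rightarrow> real set"

(* Completion time of a phase that begins at time b, for a job executing exactly at the instants
   in X. The infimum is \<infinity> if the computation is never completed. *)
fun phase_end :: "real set \<Rightarrow> ereal \<Rightarrow> phase \<Rightarrow> ereal" where
  "phase_end X b (Comp c) =
     (INF t\<in>{t. b \<le> ereal t \<and> c \<le> measure lborel (X \<inter> {s. b \<le> ereal s \<and> s < t})}. ereal t)"
| "phase_end X b (Susp s) = b + ereal s"

(* phase_start \<sigma> E i j m is the time at which the m-th phase of job j of task i begins; for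
   m = length (phases \<sigma> i j) it is the time at which the job finishes. A job begins its first phase
   once it has been released and the previous job of the same task has finished. *)
fun phase_start :: "scenario \<Rightarrow> schedule \<Rightarrow> nat \<Rightarrow> nat \<Rightarrow> nat \<Rightarrow> ereal" where
  "phase_start \<sigma> E i 0 0 = ereal (release \<sigma> i 0)"
| "phase_start \<sigma> E i (Suc j) 0 =
     max (ereal (release \<sigma> i (Suc j))) (phase_start \<sigma> E i j (length (phases \<sigma> i j)))"
| "phase_start \<sigma> E i j (Suc m) = phase_end (E i j) (phase_start \<sigma> E i j m) (phases \<sigma> i j ! m)"

definition finish_time :: "scenario \<Rightarrow> schedule \<Rightarrow> nat \<Rightarrow> nat \<Rightarrow> ereal" where
  "finish_time \<sigma> E i j = phase_start \<sigma> E i j (length (phases \<sigma> i j))"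

definition ready :: "scenario \<Rightarrow> schedule \<Rightarrow> nat \<Rightarrow> nat \<Rightarrow> real \<Rightarrow> bool" where
  "ready \<sigma> E i j t \<longleftrightarrow>
     enat j < num_jobs \<sigma> i \<and>
     (\<exists>m < length (phases \<sigma> i j). is_comp (phases \<sigma> i j ! m) \<and>
        phase_start \<sigma> E i j m \<le> ereal t \<and> ereal t < phase_start \<sigma> E i j (Suc m))"

(* At any instant at most one job of each task is ready, so counting the higher-priority tasks with
   a ready job amounts to counting the ready jobs of higher priority. Readiness at t depends on E
   only before t. Each ready set is a finite union of half-open intervals, so the equivalence
   forces E i j to be Borel for i in 1..n; no separate measurability condition is needed. *)
definition global_fp_schedule :: "nat \<Rightarrow> nat \<Rightarrow> scenario \<Rightarrow> schedule \<Rightarrow> bool" where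
  "global_fp_schedule n M \<sigma> E \<longleftrightarrow>
     (\<forall>i\<in>{1..n}. \<forall>j t. t \<in> E i j \<longleftrightarrow>
        ready \<sigma> E i j t \<and> card {h\<in>{1..<i}. \<exists>l. ready \<sigma> E h l t} < M)"

definition schedulable :: "nat \<Rightarrow> nat \<Rightarrow> (nat \<Rightarrow> task) \<Rightarrow> nat \<Rightarrow> bool" where
  "schedulable n M \<tau> i \<longleftrightarrow>
     (\<forall>\<sigma> E. admissible_scenario n \<tau> \<sigma> \<longrightarrow> global_fp_schedule n M \<sigma> E \<longrightarrow>
        (\<forall>j. enat j < num_jobs \<sigma> i \<longrightarrow>
             finish_time \<sigma> E i j \<le> ereal (release \<sigma> i j + period (\<tau> i))))"

end

theory Submission imports Defs begin

text \<open>Write C, S, T for the execution bound, suspension bound and period of a task. Consider the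
  first job of task k that misses its deadline, released at r. Up to any time r + t not beyond the
  deadline it computes and suspends for less than C k + S k in total, and whenever it is ready but
  not executing, all M processors are busy with higher-priority tasks. A schedulable task i executes
  for at most (\<lceil>t / T i\<rceil> + 1) C i in a window of length t. Hence t is less than C k + S k plus
  1 / M times the sum of these bounds over i < k, for every t in [0, T k]. Evaluating this at T k and
  at its roundings down to multiples of each T i gives a finite system of linear inequalities
  that forces the hyperbolic expression above 3.\<close>

section \<open>Linear inequalities that force the hyperbolic expression\<close>

text \<open>Elements are inserted in nondecreasing order of \<open>x\<close>. The bound on
  \<open>x m\<close> for the newest element involves only elements inserted before it, so including
  \<open>m\<close> multiplies the running total \<open>A + (\<Sum>i\<in>S. u i * x i)\<close> by at
  most \<open>u m + 1\<close>; the product collects these factors.\<close>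

lemma finite_hyperbolic_bound:
  fixes x u :: "'a \<Rightarrow> real"
  assumes "finite S" "\<And>i. i \<in> S \<Longrightarrow> 0 \<le> u i" "\<And>i. i \<in> S \<Longrightarrow> 0 \<le> x i"
    and "\<And>j. j \<in> S \<Longrightarrow> x j \<le> A + (\<Sum>i | i \<in> S \<and> x i < x j. u i * x i)"
  shows "A + (\<Sum>i\<in>S. u i * x i) \<le> A * (\<Prod>i\<in>S. u i + 1)"
  using assms
proof (induction S rule: finite_ranking_induct[where f = x])
  case empty
  then show ?case by simp
next
  case (insert m S)
  have "x j \<le> A + (\<Sum>i | i \<in> S \<and> x i < x j. u i * x i)" if "j \<in> S" for j
  proof -
    \<comment> \<open>As \<open>x m\<close> is maximal, it is not strictly below any
      \<open>x j\<close>, so the hypothesis for \<open>j\<close> survives the removal of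
      \<open>m\<close>.\<close>
    have "{i. i \<in> insert m S \<and> x i < x j} = {i. i \<in> S \<and> x i < x j}"
      using insert.hyps(2)[OF that] by auto
    then show ?thesis using insert.prems(3)[of j] that by simp
  qed
  then have IH: "A + (\<Sum>i\<in>S. u i * x i) \<le> A * (\<Prod>i\<in>S. u i + 1)"
    using insert.IH insert.prems by simp
  show ?case
  proof (cases "m \<in> S")
    case True
    then show ?thesis using IH by (simp add: insert_absorb)
  next
    case False
    have "x m \<le> A + (\<Sum>i | i \<in> insert m S \<and> x i < x m. u i * x i)"
      using insert.prems(3) by blast
    also have "\<dots> \<le> A + (\<Sum>i\<in>S. u i * x i)"
      using insert.hyps(1) insert.prems by (intro add_left_mono sum_mono2) auto
    finally have "u m * x m \<le> u m * (A + (\<Sum>i\<in>S. u i * x i))"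
      using insert.prems(1) by (intro mult_left_mono) auto
    then have "A + (\<Sum>i\<in>insert m S. u i * x i) \<le> (u m + 1) * (A + (\<Sum>i\<in>S. u i * x i))"
      using False insert.hyps(1) by (simp add: algebra_simps)
    also have "\<dots> \<le> (u m + 1) * (A * (\<Prod>i\<in>S. u i + 1))"
      using IH insert.prems(1)[of m] by (intro mult_left_mono) auto
    finally show ?thesis using False insert.hyps(1) by (simp add: algebra_simps)
  qed
qed

text \<open>Two of the three copies of \<open>W\<close> go into the offset \<open>A\<close>, so
  \<open>finite_hyperbolic_bound\<close> yields \<open>A + W \<le> A * P\<close>. This bounds
  \<open>T\<close> above by \<open>A * P\<close> and \<open>c\<close> below by
  \<open>A * (3 - 2 * P)\<close>. Eliminating \<open>A\<close> leaves
  \<open>T * (3 - 2 * P) < c * P\<close>, which rearranges to the conclusion.\<close>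

lemma hyperbolic_test:
  fixes x u :: "'a \<Rightarrow> real"
  assumes "finite S" "0 < c" "0 < T"
    and nonneg: "\<And>i. i \<in> S \<Longrightarrow> 0 \<le> u i" "\<And>i. i \<in> S \<Longrightarrow> 0 \<le> x i"
    and x_less: "\<And>j. j \<in> S \<Longrightarrow>
      x j < c + 2 * (\<Sum>i\<in>S. u i * x i) + (\<Sum>i | i \<in> S \<and> x i < x j. u i * x i)"
    and T_less: "T < c + 3 * (\<Sum>i\<in>S. u i * x i)"
  shows "3 < (c / T + 2) * (\<Prod>i\<in>S. u i + 1)"
proof -
  define P where "P = (\<Prod>i\<in>S. u i + 1)"
  define W where "W = (\<Sum>i\<in>S. u i * x i)"
  define A where "A = c + 2 * W"
  have "0 \<le> W" unfolding W_def using nonneg by (intro sum_nonneg) auto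
  then have "0 < A" using \<open>0 < c\<close> by (simp add: A_def)
  have "1 \<le> P" unfolding P_def using nonneg by (intro prod_ge_1) auto
  have AW: "A + W \<le> A * P"
    unfolding W_def P_def using assms(1) nonneg x_less
    by (intro finite_hyperbolic_bound) (auto simp: A_def W_def intro: less_imp_le)
  have T: "T < A * P" using T_less AW by (simp add: A_def W_def)
  have c: "A * (3 - 2 * P) \<le> c" using AW by (simp add: A_def algebra_simps)
  have "T * (3 - 2 * P) < c * P"
  \<comment> \<open>The bound on \<open>T\<close> can be multiplied by \<open>3 - 2 * P\<close> only
    if this factor is positive; otherwise the signs of the two sides decide.\<close>
  proof (cases "0 < 3 - 2 * P")
    case True
    have "T * (3 - 2 * P) < A * P * (3 - 2 * P)" using T True by simp
    also have "\<dots> \<le> c * P" using mult_right_mono[OF c, of P] \<open>1 \<le> P\<close> by (simp add: algebra_simps)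
    finally show ?thesis .
  next
    case False
    then have "T * (3 - 2 * P) \<le> 0" using \<open>0 < T\<close> by (simp add: mult_le_0_iff)
    also have "0 < c * P" using \<open>0 < c\<close> \<open>1 \<le> P\<close> by simp
    finally show ?thesis .
  qed
  then show ?thesis
    using \<open>0 < T\<close> unfolding P_def[symmetric] by (simp add: field_simps)
qed

section \<open>Phase boundaries and measurability of the schedule\<close>

lemma phase_end_ge:
  assumes "0 \<le> phase_length p"
  shows "b \<le> phase_end X b p"
proof (cases p)
  case (Comp c)
  then show ?thesis by (auto intro: INF_greatest)
next
  case (Susp s)
  then show ?thesis using assms by (simp add: ereal_le_add_self)
qed

lemma phase_start_mono:
  assumes "\<forall>p\<in>set (phases \<sigma> i j). 0 < phase_length p" "m \<le> m'" "m' \<le> length (phases \<sigma> i j)"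
  shows "phase_start \<sigma> E i j m \<le> phase_start \<sigma> E i j m'"
  using assms(2,3)
proof (induction m' rule: dec_induct)
  case (step m')
  have "phase_start \<sigma> E i j m' \<le> phase_start \<sigma> E i j (Suc m')"
    using assms(1) step.hyps step.prems by (simp add: phase_end_ge less_imp_le)
  then show ?case using step by auto
qed simp

lemma release_le_phase_start_0: "ereal (release \<sigma> i j) \<le> phase_start \<sigma> E i j 0"
  by (cases j) auto

text \<open>Phase starts do not depend on the instant, so readiness is a finite combination of
  comparisons with constants. This holds for every \<open>E\<close>, so measurability of a schedule
  can be deduced from it without circularity.\<close>

lemma measurable_ready [measurable]: "Measurable.pred borel (ready \<sigma> E i j)"
  unfolding ready_def[abs_def] by measurable

lemma global_fp_schedule_borel:
  assumes "global_fp_schedule n M \<sigma> E" "i \<in> {1..n}"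
  shows "E i j \<in> sets borel"
proof -
  \<comment> \<open>As a finite sum of 0/1 terms, the cardinality is accessible to
    \<open>measurable\<close>.\<close>
  have card: "card {h\<in>{1..<i}. \<exists>l. ready \<sigma> E h l t}
      = (\<Sum>h\<in>{1..<i}. if \<exists>l. ready \<sigma> E h l t then 1 else 0)" for t
    by (simp add: sum.If_cases Int_def)
  have "E i j = {t\<in>space borel. ready \<sigma> E i j t
      \<and> (\<Sum>h\<in>{1..<i}. if \<exists>l. ready \<sigma> E h l t then 1 else 0) < M}"
    using assms unfolding global_fp_schedule_def card[symmetric] by auto
  also have "\<dots> \<in> sets borel" by measurable
  finally show ?thesis .
qed

section \<open>Processor time received in a phase and by a job\<close>

text \<open>If \<open>c\<close> units had been executed before \<open>x\<close>, then
  \<open>x\<close> would belong to the set whose infimum is the phase end.\<close>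

lemma measure_Int_Ico_less:
  assumes "ereal x < phase_end X (ereal b) (Comp c)" "b \<le> x"
  shows "measure lborel (X \<inter> {b..<x}) < c"
proof (rule ccontr)
  assume "\<not> ?thesis"
  moreover have "X \<inter> {b..<x} = X \<inter> {s. ereal b \<le> ereal s \<and> s < x}" by auto
  ultimately have "x \<in> {t. ereal b \<le> ereal t
      \<and> c \<le> measure lborel (X \<inter> {s. ereal b \<le> ereal s \<and> s < t})}"
    using assms(2) by simp
  then have "phase_end X (ereal b) (Comp c) \<le> ereal x"
    unfolding phase_end.simps by (rule INF_lower)
  then show False using assms(1) by simp
qed

lemma fmeasurable_Int_Ico:
  assumes "X \<in> sets borel"
  shows "X \<inter> {a..<b::real} \<in> fmeasurable lborel"
  using assms by (intro fmeasurableI2[OF fmeasurable_cbox[of a b]]) auto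

lemma measure_Int_Ico_mono:
  assumes "X \<in> sets borel" "{a..<b} \<subseteq> {a'..<b'::real}"
  shows "measure lborel (X \<inter> {a..<b}) \<le> measure lborel (X \<inter> {a'..<b'})"
proof (rule measure_mono_fmeasurable)
  show "X \<inter> {a'..<b'} \<in> fmeasurable lborel"
    using assms(1) by (rule fmeasurable_Int_Ico)
qed (use assms in auto)

lemma measure_Int_Ico_split:
  assumes "X \<in> sets borel" "a \<le> b" "b \<le> (c::real)"
  shows "measure lborel (X \<inter> {a..<c})
    = measure lborel (X \<inter> {a..<b}) + measure lborel (X \<inter> {b..<c})"
proof -
  have "X \<inter> {a..<c} = X \<inter> {a..<b} \<union> X \<inter> {b..<c}" using assms by auto
  moreover have "measure lborel (X \<inter> {a..<b} \<union> X \<inter> {b..<c})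
      = measure lborel (X \<inter> {a..<b}) + measure lborel (X \<inter> {b..<c})"
    using fmeasurable_Int_Ico[OF assms(1)] by (intro measure_Un_AE) auto
  ultimately show ?thesis by simp
qed

text \<open>The infimum bounds the execution only strictly before \<open>e\<close>. Stopping at
  \<open>x\<close>, at most \<epsilon> earlier, omits a piece of measure at most \<epsilon>, and
  \<epsilon> is arbitrary.\<close>

lemma measure_Int_phase_le:
  assumes "X \<in> sets borel" "phase_end X (ereal b) (Comp c) = ereal e" "b \<le> e" "0 \<le> c"
  shows "measure lborel (X \<inter> {b..<e}) \<le> c"
proof (cases "b < e")
  case True
  show ?thesis
  proof (rule field_le_epsilon)
    fix \<epsilon> :: real assume "0 < \<epsilon>"
    define x where "x = max b (e - \<epsilon>)"
    have x: "b \<le> x" "x < e" "e - x \<le> \<epsilon>" using True \<open>0 < \<epsilon>\<close> by (auto simp: x_def)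
    have "measure lborel (X \<inter> {x..<e}) \<le> measure lborel {x..<e}"
      using assms(1) fmeasurable_Int_Ico[of UNIV x e] by (intro measure_mono_fmeasurable) auto
    then have "measure lborel (X \<inter> {b..<e}) \<le> measure lborel (X \<inter> {b..<x}) + (e - x)"
      using measure_Int_Ico_split[OF assms(1), of b x e] x by simp
    also have "measure lborel (X \<inter> {b..<x}) < c"
      using x assms(2) by (intro measure_Int_Ico_less) auto
    finally show "measure lborel (X \<inter> {b..<e}) \<le> c + \<epsilon>" using x by simp
  qed
qed (use assms in auto)

lemma comp_time_susp_time: "comp_time ps + susp_time ps = (\<Sum>p\<leftarrow>ps. phase_length p)"
  by (induction ps) (auto simp: comp_time_def susp_time_def)

lemma comp_time_eq_sum:
  "comp_time ps = (\<Sum>m | m < length ps \<and> is_comp (ps ! m). phase_length (ps ! m))"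
proof -
  have "comp_time ps = (\<Sum>p\<leftarrow>ps. if is_comp p then phase_length p else 0)"
    by (induction ps) (auto simp: comp_time_def)
  also have "\<dots> = (\<Sum>m<length ps. if is_comp (ps ! m) then phase_length (ps ! m) else 0)"
    by (simp add: sum_list_sum_nth atLeast0LessThan)
  also have "\<dots> = (\<Sum>m | m < length ps \<and> is_comp (ps ! m). phase_length (ps ! m))"
    by (simp add: sum.If_cases Collect_conj_eq lessThan_def)
  finally show ?thesis .
qed

lemma execution_bounds:
  assumes "global_fp_schedule n M \<sigma> E" "i \<in> {1..n}"
    and pos: "\<forall>p\<in>set (phases \<sigma> i j). 0 < phase_length p"
    and "s \<in> E i j"
  shows "enat j < num_jobs \<sigma> i" "ereal (release \<sigma> i j) \<le> ereal s" "ereal s < finish_time \<sigma> E i j"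
proof -
  obtain m where m: "m < length (phases \<sigma> i j)" "phase_start \<sigma> E i j m \<le> ereal s"
      "ereal s < phase_start \<sigma> E i j (Suc m)" and "enat j < num_jobs \<sigma> i"
    using assms(1,2,4) unfolding global_fp_schedule_def ready_def by blast
  then show "enat j < num_jobs \<sigma> i" by simp
  have "ereal (release \<sigma> i j) \<le> phase_start \<sigma> E i j m"
    using phase_start_mono[OF pos, of 0 m E] m(1)
    by (intro order_trans[OF release_le_phase_start_0]) simp
  then show "ereal (release \<sigma> i j) \<le> ereal s" using m(2) order_trans by blast
  show "ereal s < finish_time \<sigma> E i j"
    unfolding finish_time_def
    using m(1) by (intro less_le_trans[OF m(3)] phase_start_mono[OF pos]) auto
qed

text \<open>A job executes only inside its computation phases, and
  \<open>measure_Int_phase_le\<close> limits each of them to its length.\<close>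

lemma emeasure_execution_le:
  assumes sched: "global_fp_schedule n M \<sigma> E" and i: "i \<in> {1..n}"
    and pos: "\<forall>p\<in>set (phases \<sigma> i j). 0 < phase_length p"
    and fin: "finish_time \<sigma> E i j < \<infinity>"
  shows "emeasure lborel (E i j) \<le> ennreal (comp_time (phases \<sigma> i j))"
proof -
  let ?ps = "phases \<sigma> i j"
  let ?M = "{m. m < length ?ps \<and> is_comp (?ps ! m)}"
  \<comment> \<open>Nothing is lost by \<open>real_of_ereal\<close>: every phase boundary lies
    between the release and the finite finish time.\<close>
  define b where "b m = real_of_ereal (phase_start \<sigma> E i j m)" for m
  have start: "phase_start \<sigma> E i j m = ereal (b m)" if "m \<le> length ?ps" for m
  proof -
    have "phase_start \<sigma> E i j m \<le> finish_time \<sigma> E i j"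
      unfolding finish_time_def using phase_start_mono[OF pos that] by simp
    then have "phase_start \<sigma> E i j m \<noteq> \<infinity>" using fin by auto
    moreover have "ereal (release \<sigma> i j) \<le> phase_start \<sigma> E i j m"
      using phase_start_mono[OF pos, of 0 m E] that
      by (intro order_trans[OF release_le_phase_start_0]) simp
    then have "phase_start \<sigma> E i j m \<noteq> -\<infinity>" by auto
    ultimately show ?thesis by (cases "phase_start \<sigma> E i j m") (auto simp: b_def)
  qed
  note [measurable] = global_fp_schedule_borel[OF sched i, of j]
  have "E i j \<subseteq> (\<Union>m\<in>?M. E i j \<inter> {b m..<b (Suc m)})"
  proof
    fix s assume s: "s \<in> E i j"
    then obtain m where m: "m < length ?ps" "is_comp (?ps ! m)" "phase_start \<sigma> E i j m \<le> ereal s"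
      "ereal s < phase_start \<sigma> E i j (Suc m)"
      using sched i unfolding global_fp_schedule_def ready_def by blast
    then show "s \<in> (\<Union>m\<in>?M. E i j \<inter> {b m..<b (Suc m)})"
      using s start[of m] start[of "Suc m"] by (auto simp del: phase_start.simps)
  qed
  then have "emeasure lborel (E i j) \<le> emeasure lborel (\<Union>m\<in>?M. E i j \<inter> {b m..<b (Suc m)})"
    by (intro emeasure_mono) auto
  also have "\<dots> \<le> (\<Sum>m\<in>?M. emeasure lborel (E i j \<inter> {b m..<b (Suc m)}))"
    by (intro emeasure_subadditive_finite) auto
  also have "\<dots> \<le> (\<Sum>m\<in>?M. ennreal (phase_length (?ps ! m)))"
  proof (rule sum_mono)
    fix m assume m: "m \<in> ?M"
    then obtain c where c: "?ps ! m = Comp c" by (cases "?ps ! m") auto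
    have "0 < c" using pos m c nth_mem by fastforce
    have "b m \<le> b (Suc m)"
      using phase_start_mono[OF pos, of m "Suc m" E] start[of m] start[of "Suc m"] m
      by (simp del: phase_start.simps)
    moreover have "phase_end (E i j) (ereal (b m)) (Comp c) = ereal (b (Suc m))"
      using start[of m] start[of "Suc m"] m c by simp
    ultimately have "measure lborel (E i j \<inter> {b m..<b (Suc m)}) \<le> c"
      using \<open>0 < c\<close> by (intro measure_Int_phase_le) auto
    moreover have "E i j \<inter> {b m..<b (Suc m)} \<in> fmeasurable lborel"
      by (intro fmeasurable_Int_Ico) auto
    ultimately show "emeasure lborel (E i j \<inter> {b m..<b (Suc m)}) \<le> ennreal (phase_length (?ps ! m))"
      using c by (simp add: emeasure_eq_measure2 ennreal_leI)
  qed
  also have "\<dots> = ennreal (comp_time ?ps)"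
    unfolding comp_time_eq_sum using pos by (intro sum_ennreal) (auto intro: less_imp_le)
  finally show ?thesis .
qed

section \<open>Workload of a task in a window\<close>

lemma release_separation:
  assumes "\<And>j. enat (Suc j) < num_jobs \<sigma> i \<Longrightarrow> release \<sigma> i j + T \<le> release \<sigma> i (Suc j)"
    and "j \<le> j'" "enat j' < num_jobs \<sigma> i"
  shows "release \<sigma> i j + real (j' - j) * T \<le> release \<sigma> i j'"
  using assms(2,3)
proof (induction j' rule: dec_induct)
  case (step j')
  have "enat j' < num_jobs \<sigma> i" using step.prems by (meson enat_ord_simps(2) lessI less_trans)
  then have "release \<sigma> i j + real (j' - j) * T + T \<le> release \<sigma> i (Suc j')"
    using step.IH assms(1)[OF step.prems] by simp
  then show ?case using step.hyps by (simp add: Suc_diff_le algebra_simps)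
qed simp

text \<open>Counted from the least index \<open>j0\<close> in \<open>J\<close>, separation forces
  \<open>real (j - j0) * T < t + T\<close>. So the offset is at most
  \<open>\<lceil>t / T\<rceil>\<close>, and offset 0 accounts for the additional 1.\<close>

lemma card_released_in_window:
  assumes sep: "\<And>j. enat (Suc j) < num_jobs \<sigma> i \<Longrightarrow> release \<sigma> i j + T \<le> release \<sigma> i (Suc j)"
    and "0 < T"
    and J: "J \<subseteq> {j. enat j < num_jobs \<sigma> i \<and> r - T < release \<sigma> i j \<and> release \<sigma> i j < r + t}"
  shows "finite J \<and> card J \<le> nat (\<lceil>t / T\<rceil> + 1)"
proof (cases "J = {}")
  case False
  define j0 where "j0 = (LEAST j. j \<in> J)"
  have j0: "j0 \<in> J" unfolding j0_def using False by (auto intro: LeastI)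
  have "j \<in> {j0..<j0 + nat (\<lceil>t / T\<rceil> + 1)}" if j: "j \<in> J" for j
  proof -
    have "j0 \<le> j" unfolding j0_def using j by (rule Least_le)
    then have "release \<sigma> i j0 + real (j - j0) * T \<le> release \<sigma> i j"
      using sep J j by (intro release_separation) auto
    moreover have "r - T < release \<sigma> i j0" "release \<sigma> i j < r + t" using J j j0 by auto
    ultimately have "real (j - j0) * T < t + T" by linarith
    then have "real (j - j0) < t / T + 1" using \<open>0 < T\<close> by (simp add: field_simps)
    then have "int (j - j0) < \<lceil>t / T\<rceil> + 1" by linarith
    then show ?thesis using \<open>j0 \<le> j\<close> by auto
  qed
  then have "J \<subseteq> {j0..<j0 + nat (\<lceil>t / T\<rceil> + 1)}" by blast
  then show ?thesis
    using finite_subset card_mono by (metis finite_atLeastLessThan card_atLeastLessThan diff_add_inverse)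
qed simp

text \<open>Deadlines being met and implicit, a job executing in the window is released after
  time r - T, where T is the period; so at most one job is carried in, hence the summand 1.\<close>

lemma workload_bound:
  assumes sched: "global_fp_schedule n M \<sigma> E" and i: "i \<in> {1..n}"
    and adm: "admissible_scenario n \<tau> \<sigma>" and T: "0 < period (\<tau> i)"
    and C: "0 \<le> wcet (\<tau> i)" and t: "0 \<le> t"
    and deadlines: "\<And>j. enat j < num_jobs \<sigma> i \<Longrightarrow>
      finish_time \<sigma> E i j \<le> ereal (release \<sigma> i j + period (\<tau> i))"
  shows "measure lborel ((\<Union>j. E i j) \<inter> {r..<r + t}) \<le> (real_of_int \<lceil>t / period (\<tau> i)\<rceil> + 1) * wcet (\<tau> i)"
proof -
  let ?N = "nat (\<lceil>t / period (\<tau> i)\<rceil> + 1)"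
  define J where "J = {j. E i j \<inter> {r..<r + t} \<noteq> {}}"
  have job: "admissible_job (\<tau> i) (phases \<sigma> i j)" if "enat j < num_jobs \<sigma> i" for j
    using adm i that unfolding admissible_scenario_def by blast
  have exec: "enat j < num_jobs \<sigma> i" if "s \<in> E i j" for j s
    using sched i that unfolding global_fp_schedule_def ready_def by blast
  have J: "J \<subseteq> {j. enat j < num_jobs \<sigma> i \<and> r - period (\<tau> i) < release \<sigma> i j \<and> release \<sigma> i j < r + t}"
  proof
    fix j assume "j \<in> J"
    then obtain s where s: "s \<in> E i j" "r \<le> s" "s < r + t" unfolding J_def by auto
    have pos: "\<forall>p\<in>set (phases \<sigma> i j). 0 < phase_length p"
      using job[OF exec[OF s(1)]] unfolding admissible_job_def by blast
    note eb = execution_bounds[OF sched i pos s(1)]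
    have "ereal s < ereal (release \<sigma> i j + period (\<tau> i))"
      using eb(3) deadlines[OF eb(1)] by (rule less_le_trans)
    then show "j \<in> {j. enat j < num_jobs \<sigma> i \<and> r - period (\<tau> i) < release \<sigma> i j \<and> release \<sigma> i j < r + t}"
      using eb s by auto
  qed
  have "\<And>j. enat (Suc j) < num_jobs \<sigma> i \<Longrightarrow> release \<sigma> i j + period (\<tau> i) \<le> release \<sigma> i (Suc j)"
    using adm i unfolding admissible_scenario_def by blast
  from card_released_in_window[OF this T J] have fin: "finite J" and card: "card J \<le> ?N" by auto
  note [measurable] = global_fp_schedule_borel[OF sched i]
  \<comment> \<open>Dropping the window on the right charges each job in \<open>J\<close> for all of
    its execution, even if only a part falls inside.\<close>
  have "emeasure lborel ((\<Union>j. E i j) \<inter> {r..<r + t}) \<le> emeasure lborel (\<Union>j\<in>J. E i j)"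
    by (intro emeasure_mono) (auto simp: J_def)
  also have "\<dots> \<le> (\<Sum>j\<in>J. emeasure lborel (E i j))"
    using fin by (intro emeasure_subadditive_finite) auto
  also have "\<dots> \<le> (\<Sum>j\<in>J. ennreal (wcet (\<tau> i)))"
  proof (rule sum_mono)
    fix j assume "j \<in> J"
    then have j: "enat j < num_jobs \<sigma> i" using J by auto
    have "emeasure lborel (E i j) \<le> ennreal (comp_time (phases \<sigma> i j))"
      using job[OF j] deadlines[OF j] unfolding admissible_job_def
      by (intro emeasure_execution_le[OF sched i]) (auto intro: le_less_trans)
    also have "\<dots> \<le> ennreal (wcet (\<tau> i))"
      using job[OF j] unfolding admissible_job_def by (intro ennreal_leI) auto
    finally show "emeasure lborel (E i j) \<le> ennreal (wcet (\<tau> i))" .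
  qed
  also have "\<dots> = ennreal (real (card J) * wcet (\<tau> i))"
    using C by (simp add: ennreal_mult ennreal_of_nat_eq_real_of_nat)
  also have "\<dots> \<le> ennreal ((real_of_int \<lceil>t / period (\<tau> i)\<rceil> + 1) * wcet (\<tau> i))"
  proof (intro ennreal_leI mult_right_mono)
    have "0 \<le> \<lceil>t / period (\<tau> i)\<rceil>" using T t by (simp add: less_le_trans[of _ 0])
    then show "real (card J) \<le> real_of_int \<lceil>t / period (\<tau> i)\<rceil> + 1" using card by linarith
  qed (use C in auto)
  finally have "emeasure lborel ((\<Union>j. E i j) \<inter> {r..<r + t})
      \<le> ennreal ((real_of_int \<lceil>t / period (\<tau> i)\<rceil> + 1) * wcet (\<tau> i))" .
  moreover have "0 \<le> real_of_int \<lceil>t / period (\<tau> i)\<rceil>"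
    using T t by (simp add: less_le_trans[of _ 0])
  ultimately show ?thesis
    using C unfolding measure_def by (intro enn2real_leI) auto
qed

section \<open>Elapsed time of an unfinished job\<close>

text \<open>Induction over the phases. A suspension phase still in progress has lasted less than its
  length. In a computation phase every instant belongs to \<open>E i j\<close> or to
  \<open>B\<close>, and the part in \<open>E i j\<close> is less than the length of the phase until
  it ends.\<close>

lemma pending_time_bound:
  fixes \<sigma> E i j
  defines "B \<equiv> {s. ready \<sigma> E i j s} - E i j"
  assumes Em: "E i j \<in> sets borel" and job: "enat j < num_jobs \<sigma> i"
    and pos: "\<forall>p\<in>set (phases \<sigma> i j). 0 < phase_length p"
    and start: "phase_start \<sigma> E i j 0 = ereal r"
    and "m \<le> length (phases \<sigma> i j)" "r \<le> x" "ereal x < phase_start \<sigma> E i j m"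
  shows "x - r < (\<Sum>p\<leftarrow>take m (phases \<sigma> i j). phase_length p) + measure lborel (B \<inter> {r..<x})"
  using assms(6-)
proof (induction m arbitrary: x)
  case 0
  then show ?case using start by simp
next
  case (Suc m)
  let ?ps = "phases \<sigma> i j"
  let ?L = "\<Sum>p\<leftarrow>take m ?ps. phase_length p"
  have m: "m < length ?ps" using Suc.prems by simp
  have L: "(\<Sum>p\<leftarrow>take (Suc m) ?ps. phase_length p) = ?L + phase_length (?ps ! m)"
    using m by (simp add: take_Suc_conv_app_nth)
  have plen: "0 < phase_length (?ps ! m)" using pos m by simp
  have Bm [measurable]: "B \<in> sets borel"
    unfolding B_def using Em by measurable
  have ge: "ereal r \<le> phase_start \<sigma> E i j m"
    using phase_start_mono[OF pos, of 0 m E] start m by simp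
  show ?case
  proof (cases "ereal x < phase_start \<sigma> E i j m")
    case True
    then show ?thesis using Suc.IH[of x] Suc.prems L plen by simp
  next
    case False
    then obtain b where b: "phase_start \<sigma> E i j m = ereal b" "r \<le> b" "b \<le> x"
      using ge by (cases "phase_start \<sigma> E i j m") auto
    \<comment> \<open>The induction hypothesis covers only instants strictly before
      \<open>b\<close>, so the limit at \<open>b\<close> gives a weak inequality. Strictness is
      regained in the current phase.\<close>
    have "b - r \<le> ?L + measure lborel (B \<inter> {r..<b})"
    proof (cases "r < b")
      case True
      have "b \<le> r + ?L + measure lborel (B \<inter> {r..<b})"
      proof (rule dense_le_bounded[OF True])
        fix y assume y: "r < y" "y < b"
        then have "y - r < ?L + measure lborel (B \<inter> {r..<y})"
          using Suc.IH[of y] Suc.prems b by simp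
        also have "measure lborel (B \<inter> {r..<y}) \<le> measure lborel (B \<inter> {r..<b})"
          using y by (intro measure_Int_Ico_mono) auto
        finally show "y \<le> r + ?L + measure lborel (B \<inter> {r..<b})" by simp
      qed
      then show ?thesis by simp
    next
      case False
      have "0 \<le> ?L"
        using pos by (intro sum_list_nonneg) (auto dest!: in_set_takeD intro: less_imp_le)
      then show ?thesis using False b(2) by (simp add: add_nonneg_nonneg)
    qed
    moreover have "x - b < phase_length (?ps ! m) + measure lborel (B \<inter> {b..<x})"
    proof (cases "?ps ! m")
      case (Susp s)
      then have "x < b + s" using Suc.prems b by simp
      moreover have "0 \<le> measure lborel (B \<inter> {b..<x})" by simp
      ultimately show ?thesis unfolding Susp phase_length.simps by linarith
    next
      case (Comp c)
      have E: "measure lborel (E i j \<inter> {b..<x}) < c"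
        using Suc.prems b Comp by (intro measure_Int_Ico_less) auto
      have "ready \<sigma> E i j s" if "s \<in> {b..<x}" for s
      proof -
        have "ereal s < phase_start \<sigma> E i j (Suc m)"
          using that Suc.prems(3) by (metis atLeastLessThan_iff ereal_less(2) less_ereal.simps(1) less_trans)
        moreover have "phase_start \<sigma> E i j m \<le> ereal s" using that b by simp
        moreover have "is_comp (?ps ! m)" using Comp by simp
        ultimately show ?thesis unfolding ready_def using job m by blast
      qed
      then have "{b..<x} = E i j \<inter> {b..<x} \<union> B \<inter> {b..<x}" unfolding B_def by auto
      then have "measure lborel {b..<x} \<le> measure lborel (E i j \<inter> {b..<x}) + measure lborel (B \<inter> {b..<x})"
        using Em Bm measure_Un_le[of "E i j \<inter> {b..<x}" lborel "B \<inter> {b..<x}"] by auto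
      then show ?thesis using E Comp b by simp
    qed
    ultimately show ?thesis
      using L measure_Int_Ico_split[OF Bm b(2,3)] by simp
  qed
qed

section \<open>Blocking by higher-priority tasks\<close>

text \<open>Otherwise take the least \<open>h\<close> in \<open>A\<close> outside the set. All
  smaller elements of \<open>A\<close> lie in the set, so there are fewer than \<open>M\<close> of
  them, and \<open>h\<close> qualifies after all.\<close>

lemma card_lowest_ge:
  fixes A :: "nat set"
  assumes "finite A" "M \<le> card A"
  shows "M \<le> card {h\<in>A. card {h'\<in>A. h' < h} < M}"
proof (rule ccontr)
  let ?F = "{h\<in>A. card {h'\<in>A. h' < h} < M}"
  assume "\<not> ?thesis"
  then have F: "card ?F < M" by simp
  then have "A \<noteq> ?F" using assms(2) by auto
  then have ex: "\<exists>h. h \<in> A - ?F" by blast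
  define h where "h = (LEAST h. h \<in> A - ?F)"
  have h: "h \<in> A - ?F" unfolding h_def using ex by (rule LeastI_ex)
  have "{h'\<in>A. h' < h} \<subseteq> ?F"
    using not_less_Least[of _ "\<lambda>h. h \<in> A - ?F"] unfolding h_def[symmetric] by blast
  then have "card {h'\<in>A. h' < h} \<le> card ?F" using assms(1) by (intro card_mono) auto
  then show False using F h by auto
qed

text \<open>The schedule directly provides only \<open>M\<close> ready tasks of higher priority.
  Those with fewer than \<open>M\<close> ready tasks above them do execute, and
  \<open>card_lowest_ge\<close> shows that there are at least \<open>M\<close> of these.\<close>

lemma blocked_imp_processors_busy:
  assumes sched: "global_fp_schedule n M \<sigma> E" and k: "k \<in> {1..n}"
    and s: "ready \<sigma> E k j s" "s \<notin> E k j"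
  shows "M \<le> card {h\<in>{1..<k}. \<exists>l. s \<in> E h l}"
proof -
  let ?A = "{h\<in>{1..<k}. \<exists>l. ready \<sigma> E h l s}"
  have "M \<le> card ?A" using sched k s unfolding global_fp_schedule_def by force
  then have "M \<le> card {h\<in>?A. card {h'\<in>?A. h' < h} < M}" by (intro card_lowest_ge) auto
  also have "\<dots> \<le> card {h\<in>{1..<k}. \<exists>l. s \<in> E h l}"
  proof (intro card_mono subsetI)
    fix h assume h: "h \<in> {h\<in>?A. card {h'\<in>?A. h' < h} < M}"
    then obtain l where "ready \<sigma> E h l s" by blast
    moreover have "{h'\<in>?A. h' < h} = {h'\<in>{1..<h}. \<exists>l. ready \<sigma> E h' l s}" using h by auto
    ultimately have "s \<in> E h l" using sched k h unfolding global_fp_schedule_def by auto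
    then show "h \<in> {h\<in>{1..<k}. \<exists>l. s \<in> E h l}" using h by auto
  qed auto
  finally show ?thesis .
qed

text \<open>Integration of a pointwise inequality: at each blocked instant at least \<open>M\<close>
  of the indicators on the right are 1.\<close>

lemma blocked_time_bound:
  assumes sched: "global_fp_schedule n M \<sigma> E" and k: "k \<in> {1..n}"
  shows "real M * measure lborel (({s. ready \<sigma> E k j s} - E k j) \<inter> {a..<b})
    \<le> (\<Sum>h\<in>{1..<k}. measure lborel ((\<Union>l. E h l) \<inter> {a..<b}))"
proof -
  let ?B = "({s. ready \<sigma> E k j s} - E k j) \<inter> {a..<b}"
  let ?W = "\<lambda>h. (\<Union>l. E h l) \<inter> {a..<b}"
  have "{s. ready \<sigma> E k j s} - E k j \<in> sets borel"
    using global_fp_schedule_borel[OF sched k, of j] by measurable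
  then have B: "?B \<in> fmeasurable lborel" by (rule fmeasurable_Int_Ico)
  have W: "?W h \<in> fmeasurable lborel" if "h \<in> {1..<k}" for h
    using that k global_fp_schedule_borel[OF sched, of h] by (intro fmeasurable_Int_Ico sets.countable_UN) auto
  have ind: "real M * indicator ?B s \<le> (\<Sum>h\<in>{1..<k}. indicator (?W h) s :: real)" for s
  proof (cases "s \<in> ?B")
    case True
    have "(\<Sum>h\<in>{1..<k}. indicator (?W h) s :: real) = real (card {h\<in>{1..<k}. \<exists>l. s \<in> E h l})"
      using True by (simp add: indicator_def sum.If_cases Int_def)
    then show ?thesis using True blocked_imp_processors_busy[OF sched k, of j s] by simp
  qed (simp add: sum_nonneg)
  have "real M * measure lborel ?B = (\<integral>s. real M * indicator ?B s \<partial>lborel)" by simp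
  also have "\<dots> \<le> (\<integral>s. (\<Sum>h\<in>{1..<k}. indicator (?W h) s) \<partial>lborel)"
    using B W ind by (intro integral_mono integrable_mult_right Bochner_Integration.integrable_sum)
      (auto intro!: integrable_real_indicator simp: fmeasurable_def)
  also have "\<dots> = (\<Sum>h\<in>{1..<k}. (\<integral>s. indicator (?W h) s \<partial>lborel))"
    using W by (intro Bochner_Integration.integral_sum)
      (auto intro!: integrable_real_indicator simp: fmeasurable_def)
  finally show ?thesis by simp
qed

section \<open>Contradiction from a first deadline miss\<close>

theorem theorem5:
  fixes n M k :: nat and \<tau> :: "nat \<Rightarrow> task"
  assumes "M \<ge> 1" and "2 \<le> k" and "k \<le> n"
    and "task_system n \<tau>" and "rate_monotonic n \<tau>"
    and "\<And>i. i \<in> {1..<k} \<Longrightarrow> schedulable n M \<tau> i"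
    and "((wcet (\<tau> k) + max_susp (\<tau> k)) / period (\<tau> k) + 2)
           * (\<Prod>j\<in>{1..<k}. utilization (\<tau> j) / real M + 1) \<le> 3"
  shows "schedulable n M \<tau> k"
proof (rule ccontr)
  assume "\<not> schedulable n M \<tau> k"
  then obtain \<sigma> E where adm: "admissible_scenario n \<tau> \<sigma>" and sched: "global_fp_schedule n M \<sigma> E"
    and miss: "\<exists>j. enat j < num_jobs \<sigma> k \<and> \<not> finish_time \<sigma> E k j \<le> ereal (release \<sigma> k j + period (\<tau> k))"
    unfolding schedulable_def by blast
  obtain j where j: "enat j < num_jobs \<sigma> k"
      and late: "ereal (release \<sigma> k j + period (\<tau> k)) < finish_time \<sigma> E k j"
      and earlier: "\<And>j'. j' < j \<Longrightarrow> enat j' < num_jobs \<sigma> k \<Longrightarrow>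
        finish_time \<sigma> E k j' \<le> ereal (release \<sigma> k j' + period (\<tau> k))"
    using exists_least_iff[THEN iffD1, OF miss] by auto
  have k: "k \<in> {1..n}" using assms(2,3) by simp
  have params: "0 < wcet (\<tau> i)" "0 \<le> max_susp (\<tau> i)" "0 < period (\<tau> i)" if "i \<in> {1..n}" for i
  proof -
    have "wcet (\<tau> i) > 0 \<and> max_susp (\<tau> i) \<ge> 0 \<and> wcet (\<tau> i) + max_susp (\<tau> i) \<le> period (\<tau> i)"
      using assms(4) that unfolding task_system_def by blast
    then show "0 < wcet (\<tau> i)" "0 \<le> max_susp (\<tau> i)" "0 < period (\<tau> i)" by linarith+
  qed
  define r where "r = release \<sigma> k j"
  define T where "T = period (\<tau> k)"
  define c where "c = wcet (\<tau> k) + max_susp (\<tau> k)"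
  define u where "u i = utilization (\<tau> i) / real M" for i
  \<comment> \<open>\<open>T\<close> rounded down to a multiple of the period of \<open>i\<close>.
    The workload bound divided by \<open>M\<close> is at most \<open>2 * (u i * x i)\<close> up to
    \<open>x i\<close> and at most \<open>3 * (u i * x i)\<close> up to \<open>T\<close>; see
    \<open>two\<close> and \<open>three\<close>.\<close>
  define x where "x i = real_of_int \<lfloor>T / period (\<tau> i)\<rfloor> * period (\<tau> i)" for i
  let ?S = "{1..<k}"
  have hp: "i \<in> {1..n}" if "i \<in> ?S" for i using that assms(3) by auto
  have job: "admissible_job (\<tau> k) (phases \<sigma> k j)"
    using adm k j unfolding admissible_scenario_def by blast
  then have pos: "\<forall>p\<in>set (phases \<sigma> k j). 0 < phase_length p" unfolding admissible_job_def by blast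
  \<comment> \<open>The preceding job meets its deadline, which is no later than \<open>r\<close>,
    so job \<open>j\<close> is not delayed by its own task.\<close>
  have start: "phase_start \<sigma> E k j 0 = ereal r"
  proof (cases j)
    case (Suc j')
    have "enat j' < num_jobs \<sigma> k" using j Suc by (meson enat_ord_simps(2) lessI less_trans)
    then have "finish_time \<sigma> E k j' \<le> ereal (release \<sigma> k j' + period (\<tau> k))"
      using earlier Suc by simp
    also have "\<dots> \<le> ereal (release \<sigma> k j)"
      using adm k j Suc unfolding admissible_scenario_def by auto
    finally show ?thesis using Suc unfolding r_def finish_time_def by (simp add: max_def)
  qed (simp add: r_def)
  have demand: "t < c + (\<Sum>i\<in>?S. (real_of_int \<lceil>t / period (\<tau> i)\<rceil> + 1) * wcet (\<tau> i)) / real M"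
    if "0 \<le> t" "t \<le> T" for t
  proof -
    let ?B = "{s. ready \<sigma> E k j s} - E k j"
    have "ereal (r + t) \<le> ereal (r + T)" using that by simp
    also have "\<dots> < finish_time \<sigma> E k j" using late by (simp add: r_def T_def)
    finally have "(r + t) - r < (\<Sum>p\<leftarrow>take (length (phases \<sigma> k j)) (phases \<sigma> k j). phase_length p)
        + measure lborel (?B \<inter> {r..<r + t})"
      using global_fp_schedule_borel[OF sched k] j pos start that unfolding finish_time_def
      by (intro pending_time_bound) auto
    also have "(\<Sum>p\<leftarrow>take (length (phases \<sigma> k j)) (phases \<sigma> k j). phase_length p) \<le> c"
      using job comp_time_susp_time[of "phases \<sigma> k j"] unfolding admissible_job_def c_def by simp
    finally have pending: "t < c + measure lborel (?B \<inter> {r..<r + t})" by simp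
    have "real M * measure lborel (?B \<inter> {r..<r + t})
        \<le> (\<Sum>i\<in>?S. (real_of_int \<lceil>t / period (\<tau> i)\<rceil> + 1) * wcet (\<tau> i))"
    proof (rule order_trans[OF blocked_time_bound[OF sched k]], rule sum_mono)
      fix i assume i: "i \<in> ?S"
      show "measure lborel ((\<Union>l. E i l) \<inter> {r..<r + t})
          \<le> (real_of_int \<lceil>t / period (\<tau> i)\<rceil> + 1) * wcet (\<tau> i)"
        \<comment> \<open>Schedulability ranges over all scenarios and schedules, so it supplies the
          deadlines of task \<open>i\<close> in the very schedule where task \<open>k\<close>
          fails.\<close>
        using assms(6)[OF i] adm sched params[OF hp[OF i]] that unfolding schedulable_def
        by (intro workload_bound[OF sched hp[OF i] adm]) auto
    qed
    then have "measure lborel (?B \<inter> {r..<r + t})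
        \<le> (\<Sum>i\<in>?S. (real_of_int \<lceil>t / period (\<tau> i)\<rceil> + 1) * wcet (\<tau> i)) / real M"
      using assms(1) by (simp only: pos_le_divide_eq mult.commute of_nat_0_less_iff)
    then show ?thesis using pending by linarith
  qed
  have period_le: "period (\<tau> i) \<le> T" if "i \<in> ?S" for i
    using assms(5) that hp[OF that] k unfolding rate_monotonic_def T_def by auto
  \<comment> \<open>Rate-monotonic priorities enter here: with the floor at least 1, additive
    constants in job counts can be absorbed into multiples of it.\<close>
  have one_le: "1 \<le> real_of_int \<lfloor>T / period (\<tau> i)\<rfloor>" if "i \<in> ?S" for i
    using period_le[OF that] params(3)[OF hp[OF that]] by simp
  have x_le: "x i \<le> T" and x_nonneg: "0 \<le> x i" if "i \<in> ?S" for i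
  proof -
    have "x i \<le> T / period (\<tau> i) * period (\<tau> i)"
      unfolding x_def using params(3)[OF hp[OF that]] by (intro mult_right_mono) auto
    then show "x i \<le> T" using params(3)[OF hp[OF that]] by simp
    show "0 \<le> x i" unfolding x_def using one_le[OF that] params(3)[OF hp[OF that]] by simp
  qed
  have u_nonneg: "0 \<le> u i" if "i \<in> ?S" for i
    unfolding u_def utilization_def using params[OF hp[OF that]] by simp
  have ux: "u i * x i = real_of_int \<lfloor>T / period (\<tau> i)\<rfloor> * wcet (\<tau> i) / real M" if "i \<in> ?S" for i
    unfolding u_def x_def utilization_def using params(3)[OF hp[OF that]] by simp
  \<comment> \<open>By \<open>ux\<close>, comparing a job count with a multiple of the floor
    suffices to compare workloads.\<close>
  have scale: "a * wcet (\<tau> i) / real M \<le> q * (u i * x i)"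
    if "i \<in> ?S" "a \<le> q * real_of_int \<lfloor>T / period (\<tau> i)\<rfloor>" for a q i
  proof -
    have "a * (wcet (\<tau> i) / real M) \<le> q * real_of_int \<lfloor>T / period (\<tau> i)\<rfloor> * (wcet (\<tau> i) / real M)"
      using that(2) params(1)[OF hp[OF that(1)]] by (intro mult_right_mono) auto
    then show ?thesis using ux[OF that(1)] by (simp add: algebra_simps)
  qed
  have three: "(real_of_int \<lceil>t / period (\<tau> i)\<rceil> + 1) * wcet (\<tau> i) / real M \<le> 3 * (u i * x i)"
    if "t \<le> T" "i \<in> ?S" for t i
  proof (rule scale[OF that(2)])
    have "\<lceil>t / period (\<tau> i)\<rceil> \<le> \<lceil>T / period (\<tau> i)\<rceil>"
      using that(1) params(3)[OF hp[OF that(2)]] by (intro ceiling_mono divide_right_mono) auto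
    \<comment> \<open>One job is lost to rounding up and one to carry-in, so the count is at most
      the floor plus 2, hence at most three times the floor.\<close>
    then have "\<lceil>t / period (\<tau> i)\<rceil> \<le> \<lfloor>T / period (\<tau> i)\<rfloor> + 1"
      using ceiling_diff_floor_le_1[of "T / period (\<tau> i)"] by linarith
    then show "real_of_int \<lceil>t / period (\<tau> i)\<rceil> + 1 \<le> 3 * real_of_int \<lfloor>T / period (\<tau> i)\<rfloor>"
      using one_le[OF that(2)] by linarith
  qed
  have two: "(real_of_int \<lceil>t / period (\<tau> i)\<rceil> + 1) * wcet (\<tau> i) / real M \<le> 2 * (u i * x i)"
    if "t \<le> x i" "i \<in> ?S" for t i
  proof (rule scale[OF that(2)])
    \<comment> \<open>Up to \<open>x i\<close> rounding up costs no extra job, and only the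
      carried-in one remains.\<close>
    have "t / period (\<tau> i) \<le> real_of_int \<lfloor>T / period (\<tau> i)\<rfloor>"
      using that(1) params(3)[OF hp[OF that(2)]] unfolding x_def by (simp add: field_simps)
    then have "\<lceil>t / period (\<tau> i)\<rceil> \<le> \<lfloor>T / period (\<tau> i)\<rfloor>" by (rule ceiling_le)
    then show "real_of_int \<lceil>t / period (\<tau> i)\<rceil> + 1 \<le> 2 * real_of_int \<lfloor>T / period (\<tau> i)\<rfloor>"
      using one_le[OF that(2)] by linarith
  qed
  have "3 < (c / T + 2) * (\<Prod>i\<in>?S. u i + 1)"
  proof (rule hyperbolic_test)
    show "0 < c" "0 < T" using params[OF k] by (auto simp: c_def T_def)
    show "0 \<le> u i" "0 \<le> x i" if "i \<in> ?S" for i using u_nonneg x_nonneg that by auto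
    have "T < c + (\<Sum>i\<in>?S. (real_of_int \<lceil>T / period (\<tau> i)\<rceil> + 1) * wcet (\<tau> i) / real M)"
      using demand[of T] params(3)[OF k] by (simp add: T_def sum_divide_distrib)
    also have "\<dots> \<le> c + (\<Sum>i\<in>?S. 3 * (u i * x i))"
      by (intro add_left_mono sum_mono three) auto
    finally show "T < c + 3 * (\<Sum>i\<in>?S. u i * x i)" by (simp add: sum_distrib_left)
    fix h assume h: "h \<in> ?S"
    have "x h < c + (\<Sum>i\<in>?S. (real_of_int \<lceil>x h / period (\<tau> i)\<rceil> + 1) * wcet (\<tau> i) / real M)"
      using demand[OF x_nonneg[OF h] x_le[OF h]] by (simp add: sum_divide_distrib)
    \<comment> \<open>The third copy is charged only to tasks with \<open>x i < x h\<close>; for the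
      others \<open>x h \<le> x i\<close>, so \<open>two\<close> applies.\<close>
    also have "\<dots> \<le> c + (\<Sum>i\<in>?S. 2 * (u i * x i) + (if x i < x h then u i * x i else 0))"
    proof (intro add_left_mono sum_mono)
      fix i assume i: "i \<in> ?S"
      show "(real_of_int \<lceil>x h / period (\<tau> i)\<rceil> + 1) * wcet (\<tau> i) / real M
          \<le> 2 * (u i * x i) + (if x i < x h then u i * x i else 0)"
        using three[OF x_le[OF h] i] two[of "x h" i] i by auto
    qed
    also have "\<dots> = c + 2 * (\<Sum>i\<in>?S. u i * x i) + (\<Sum>i | i \<in> ?S \<and> x i < x h. u i * x i)"
      by (simp add: sum.distrib sum_distrib_left sum.If_cases Int_def)
    finally show "x h < c + 2 * (\<Sum>i\<in>?S. u i * x i) + (\<Sum>i | i \<in> ?S \<and> x i < x h. u i * x i)" .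
  qed auto
  then show False using assms(7) unfolding c_def T_def u_def by simp
qed

end
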